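(* Let $A$ be a finite commutative ring with identity, $\sigma$ a ring automorphism of $A$, and $\delta$ a $\sigma$-derivation of $A$. Let $f(X)=\sum_{i=0}^n a_iX^i\in A[X;\sigma,\delta]$ be monic of degree $n$, and let $\mathcal{C}$ be the principal $(f,\sigma,\delta)$-code of length $n$ generated by some monic $g(X)\in A[X;\sigma,\delta]$ of degree $n-k$ (with $0\le k\le n-1$), which is a right divisor of $f$ and also a left divisor of $f$, with $f(X)=g(X)h(X)$ for some $h(X)=\sum_{i=0}^k h_iX^i\in A[X;\sigma,\delta]$. Then a parity-check matrix $H_*\in M_{n-k,n}(A)$ of $\mathcal{C}$ is given by $$\left( \begin{array}{cccccccc} h_{k} & h_{k}^{(1)} & h_{k}^{(2)} & \dots & h_{k}^{(n-k-1)} & h_{k}^{(n-k)} & \dots & h_{k}^{(n-1)}\\ 0 & \sigma(h_{k}) & h_{k+1}^{(2)} & \dots & h_{k+1}^{(n-k-1)} & h_{k+1}^{(n-k)} & \dots & h_{k+1}^{(n-1)}\\ 0 & 0 & \sigma^2(h_{k}) & \dots & h_{k+2}^{(n-k-1)} & h_{k+2}^{(n-k)} & \dots & h_{k+2}^{(n-1)} \\ \vdots & \vdots & \vdots & \vdots & \vdots & \vdots & \vdots & \vdots \\ 0 & 0 & 0 & \dots & \sigma^{n-k-1}(h_{k}) & h_{n-1}^{(n-k)} & \dots & h_{n-1}^{(n-1)} \end{array} \right),$$ that is, numbering rows by $0\le t\le n-k-1$ and columns by $0\le i\le n-1$, the $(t,i)$ entry is $h_{k+t}^{(i)}$, which equals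 $0$ for $i<t$ and $\sigma^t(h_k)$ for $i=t$. Here (1) $h_i=0$ for $k+1\le i\le n-1$; (2) for $1\le i\le n-k-1$ and $1\le j\le n-2$: $h_0^{(i)}=\delta(h_0^{(i-1)})$ and $h_j^{(i)}=\delta(h_j^{(i-1)})+\sigma(h_{j-1}^{(i-1)})$; (3) for $n-k\le i\le n-1$ and $1\le j\le n-1$: $h_0^{(i)}=\delta(h_0^{(i-1)})-a_0\sigma(h_{n-1}^{(i-1)})$ and $h_j^{(i)}=\delta(h_j^{(i-1)})+\sigma(h_{j-1}^{(i-1)})-a_j\sigma(h_{n-1}^{(i-1)})$.
   Context: A $\sigma$-derivation $\delta$ is an additive map with $\delta(ab)=\sigma(a)\delta(b)+\delta(a)b$. $A[X;\sigma,\delta]$ is the skew-polynomial ring of elements $\sum a_iX^i$ with multiplication determined by $Xa=\sigma(a)X+\delta(a)$; $(p)_l$ is the left ideal generated by $p$. With $C_f$ the companion matrix of $f$ (ones on the superdiagonal, last row $(-a_0,\dots,-a_{n-1})$, zeros elsewhere), let $T_f:A^n\to A^n$, $T_f(x_0,\dots,x_{n-1})=(\sigma(x_0),\dots,\sigma(x_{n-1}))C_f+(\delta(x_0),\dots,\delta(x_{n-1}))$, and write $(h_0^{(i)},\dots,h_{n-1}^{(i)})=T_f^i(h_0,\dots,h_k,0,\dots,0)$ for $i\ge0$, so $h_j^{(0)}=h_j$. The principal $(f,\sigma,\delta)$-code generated by a right divisor $g$ of $f$ is the set of $(d_0,\dots,d_{n-1})\in A^n$ with $\sum_{i=0}^{n-1}d_iX^i+(f)_l\in(g)_l/(f)_l$;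 for $g$ monic of degree $n-k$ it is $A$-free of rank $k$. The dual is $\mathcal{C}^\perp=\{y\in A^n:\sum_i x_iy_i=0\text{ for all }x\in\mathcal{C}\}$. A matrix $H\in M_{n,t}(A)$, $t\le n$, is a control matrix of $\mathcal{C}$ if $\mathcal{C}=\{x\in A^n:xH=0\}$. A generating matrix of a free submodule of $A^n$ is a matrix whose rows form a basis of it. For an $A$-free code $\mathcal{C}$ of length $n$ and rank $k$, a matrix $H_*\in M_{n-k,n}(A)$ is a parity-check matrix of $\mathcal{C}$ if $H_*^T$ is a control matrix of $\mathcal{C}$ and $H_*$ is a generating matrix of $\mathcal{C}^\perp$. *)

theory Defs
  imports
    "HOL-Computational_Algebra.Polynomial"
    "Jordan_Normal_Form.VS_Connect"
begin

section \<open>Skew polynomials\<close>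

text \<open>
  The left \<open>A\<close>-module underlying \<open>A[X; \<sigma>, \<delta>]\<close> is represented by the type \<^typ>\<open>'a poly\<close>,
  with coefficients written on the left of the powers of \<open>X\<close>.  Only its addition, degree and
  coefficients are used; the product is \<open>skew_mult\<close> below, never the product of the
  type \<^typ>\<open>'a poly\<close>.
\<close>

definition sigma_derivation :: "('a::ring \<Rightarrow> 'a) \<Rightarrow> ('a \<Rightarrow> 'a) \<Rightarrow> bool" where
  "sigma_derivation \<sigma> \<delta> \<longleftrightarrow>
     (\<forall>a b. \<delta> (a + b) = \<delta> a + \<delta> b) \<and>
     (\<forall>a b. \<delta> (a * b) = \<sigma> a * \<delta> b + \<delta> a * b)"

text \<open>Left multiplication by \<open>X\<close>: \<open>X (\<Sum> b\<^sub>i X\<^sup>i) = \<Sum> (\<sigma>(b\<^sub>i) X + \<delta>(b\<^sub>i)) X\<^sup>i\<close>.\<close>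

definition skew_X_mult :: "('a::comm_ring_1 \<Rightarrow> 'a) \<Rightarrow> ('a \<Rightarrow> 'a) \<Rightarrow> 'a poly \<Rightarrow> 'a poly" where
  "skew_X_mult \<sigma> \<delta> q = pCons 0 (map_poly \<sigma> q) + map_poly \<delta> q"

text \<open>\<open>(\<Sum> a\<^sub>i X\<^sup>i) q = \<Sum> a\<^sub>i (X\<^sup>i q)\<close>\<close>

definition skew_mult ::
    "('a::comm_ring_1 \<Rightarrow> 'a) \<Rightarrow> ('a \<Rightarrow> 'a) \<Rightarrow> 'a poly \<Rightarrow> 'a poly \<Rightarrow> 'a poly" where
  "skew_mult \<sigma> \<delta> p q =
     (\<Sum>i\<le>degree p. Polynomial.smult (coeff p i) ((skew_X_mult \<sigma> \<delta> ^^ i) q))"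

definition skew_poly_ring ::
    "('a::comm_ring_1 \<Rightarrow> 'a) \<Rightarrow> ('a \<Rightarrow> 'a) \<Rightarrow> 'a poly ring" where
  "skew_poly_ring \<sigma> \<delta> =
     \<lparr>carrier = UNIV, monoid.mult = skew_mult \<sigma> \<delta>, one = 1, zero = 0, add = (+)\<rparr>"

definition right_divisor ::
    "('a::comm_ring_1 \<Rightarrow> 'a) \<Rightarrow> ('a \<Rightarrow> 'a) \<Rightarrow> 'a poly \<Rightarrow> 'a poly \<Rightarrow> bool" where
  "right_divisor \<sigma> \<delta> g f \<longleftrightarrow> (\<exists>q. f = skew_mult \<sigma> \<delta> q g)"

definition left_divisor ::
    "('a::comm_ring_1 \<Rightarrow> 'a) \<Rightarrow> ('a \<Rightarrow> 'a) \<Rightarrow> 'a poly \<Rightarrow> 'a poly \<Rightarrow> bool" where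
  "left_divisor \<sigma> \<delta> g f \<longleftrightarrow> (\<exists>q. f = skew_mult \<sigma> \<delta> g q)"

definition left_ideal ::
    "('a::comm_ring_1 \<Rightarrow> 'a) \<Rightarrow> ('a \<Rightarrow> 'a) \<Rightarrow> 'a poly \<Rightarrow> 'a poly set" where
  "left_ideal \<sigma> \<delta> p = {skew_mult \<sigma> \<delta> q p | q. True}"

subsection \<open>These operations form a ring in which \<open>X a = \<sigma>(a) X + \<delta>(a)\<close>\<close>

lemma skew_mult_altdef:
  assumes "degree p \<le> N"
  shows "skew_mult \<sigma> \<delta> p q =
    (\<Sum>i\<le>N. Polynomial.smult (coeff p i) ((skew_X_mult \<sigma> \<delta> ^^ i) q))"
  unfolding skew_mult_def
  by (rule sum.mono_neutral_left) (use assms in \<open>auto simp: coeff_eq_0\<close>)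

lemma smult_sum_right:
  "Polynomial.smult a (\<Sum>i\<in>I. p i) = (\<Sum>i\<in>I. Polynomial.smult a (p i))"
  by (induction I rule: infinite_finite_induct) (auto simp: smult_add_right)

lemma skew_mult_smult_left:
  "skew_mult \<sigma> \<delta> (Polynomial.smult a p) q = Polynomial.smult a (skew_mult \<sigma> \<delta> p q)"
  by (subst (1) skew_mult_altdef[OF degree_smult_le])
     (simp add: skew_mult_def smult_sum_right)

lemma skew_mult_add_left:
  "skew_mult \<sigma> \<delta> (p + p') q = skew_mult \<sigma> \<delta> p q + skew_mult \<sigma> \<delta> p' q"
proof -
  let ?N = "max (degree p) (degree p')"
  have "degree (p + p') \<le> ?N" "degree p \<le> ?N" "degree p' \<le> ?N"
    by (auto intro: degree_add_le)
  then show ?thesis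
    by (simp add: skew_mult_altdef[where N = ?N] smult_add_left sum.distrib)
qed

lemma skew_mult_zero_left: "skew_mult \<sigma> \<delta> 0 q = 0"
  by (simp add: skew_mult_def)

lemma skew_mult_sum_left:
  "skew_mult \<sigma> \<delta> (\<Sum>i\<in>I. p i) q = (\<Sum>i\<in>I. skew_mult \<sigma> \<delta> (p i) q)"
  by (induction I rule: infinite_finite_induct)
     (auto simp: skew_mult_add_left skew_mult_zero_left)

lemma skew_mult_one_left: "skew_mult \<sigma> \<delta> 1 q = q"
  by (simp add: skew_mult_def)

lemma skew_mult_X_left: "skew_mult \<sigma> \<delta> [:0, 1:] q = skew_X_mult \<sigma> \<delta> q"
  by (simp add: skew_mult_def)

lemma skew_mult_const_left: "skew_mult \<sigma> \<delta> [:a:] q = Polynomial.smult a q"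
  by (simp add: skew_mult_def)

context
  fixes \<sigma> \<delta> :: "'a::comm_ring_1 \<Rightarrow> 'a"
  assumes \<sigma>: "comm_ring_isom \<sigma>" and \<delta>: "sigma_derivation \<sigma> \<delta>"
begin

interpretation \<sigma>: comm_ring_isom \<sigma> by (rule \<sigma>)

lemma sigma_derivation_simps:
  shows "\<delta> (a + b) = \<delta> a + \<delta> b" "\<delta> (a * b) = \<sigma> a * \<delta> b + \<delta> a * b"
    and "\<delta> 0 = 0" "\<delta> 1 = 0"
proof -
  show add: "\<delta> (a + b) = \<delta> a + \<delta> b"
    and mult: "\<delta> (a * b) = \<sigma> a * \<delta> b + \<delta> a * b" for a b
    using \<delta> by (auto simp: sigma_derivation_def)
  show "\<delta> 0 = 0" using add[of 0 0] by simp
  show "\<delta> 1 = 0" using mult[of 1 1] by simp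
qed

lemma coeff_skew_X_mult:
  "coeff (skew_X_mult \<sigma> \<delta> q) i =
     (case i of 0 \<Rightarrow> 0 | Suc j \<Rightarrow> \<sigma> (coeff q j)) + \<delta> (coeff q i)"
  by (simp add: skew_X_mult_def coeff_pCons coeff_map_poly sigma_derivation_simps
           split: nat.split)

lemma skew_X_mult_const:
  "skew_mult \<sigma> \<delta> [:0, 1:] [:a:] = Polynomial.smult (\<sigma> a) [:0, 1:] + [:\<delta> a:]"
  by (rule poly_eqI)
     (auto simp: skew_mult_X_left coeff_skew_X_mult coeff_pCons sigma_derivation_simps
           split: nat.split)

lemma skew_X_mult_add:
  "skew_X_mult \<sigma> \<delta> (p + q) = skew_X_mult \<sigma> \<delta> p + skew_X_mult \<sigma> \<delta> q"
  by (rule poly_eqI)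
     (auto simp: coeff_skew_X_mult sigma_derivation_simps \<sigma>.hom_add split: nat.split)

lemma skew_X_mult_0: "skew_X_mult \<sigma> \<delta> 0 = 0"
  by (simp add: skew_X_mult_def)

lemma skew_X_mult_sum:
  "skew_X_mult \<sigma> \<delta> (\<Sum>i\<in>I. p i) = (\<Sum>i\<in>I. skew_X_mult \<sigma> \<delta> (p i))"
  by (induction I rule: infinite_finite_induct) (auto simp: skew_X_mult_add skew_X_mult_0)

lemma skew_X_mult_smult:
  "skew_X_mult \<sigma> \<delta> (Polynomial.smult a q) =
     Polynomial.smult (\<sigma> a) (skew_X_mult \<sigma> \<delta> q) + Polynomial.smult (\<delta> a) q"
  by (rule poly_eqI)
     (auto simp: coeff_skew_X_mult sigma_derivation_simps \<sigma>.hom_mult algebra_simps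
           split: nat.split)

lemma skew_X_mult_pow_add:
  "(skew_X_mult \<sigma> \<delta> ^^ i) (p + q) = (skew_X_mult \<sigma> \<delta> ^^ i) p + (skew_X_mult \<sigma> \<delta> ^^ i) q"
  by (induction i) (auto simp: skew_X_mult_add)

lemma skew_mult_add_right:
  "skew_mult \<sigma> \<delta> p (q + q') = skew_mult \<sigma> \<delta> p q + skew_mult \<sigma> \<delta> p q'"
  by (simp add: skew_mult_def skew_X_mult_pow_add smult_add_right sum.distrib)

lemma skew_X_mult_pow_one: "(skew_X_mult \<sigma> \<delta> ^^ i) 1 = monom 1 i"
proof (induction i)
  case (Suc i)
  have "skew_X_mult \<sigma> \<delta> (monom 1 i) = monom 1 (Suc i)"
    by (rule poly_eqI)
       (auto simp: coeff_skew_X_mult sigma_derivation_simps split: nat.split)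
  then show ?case using Suc by simp
qed simp

lemma skew_mult_one_right: "skew_mult \<sigma> \<delta> p 1 = p"
  by (simp add: skew_mult_def skew_X_mult_pow_one smult_monom poly_as_sum_of_monoms)

lemma skew_mult_X_assoc:
  "skew_mult \<sigma> \<delta> (skew_X_mult \<sigma> \<delta> p) q = skew_X_mult \<sigma> \<delta> (skew_mult \<sigma> \<delta> p q)"
proof -
  have monom: "skew_mult \<sigma> \<delta> (monom a i) q =
      Polynomial.smult a ((skew_X_mult \<sigma> \<delta> ^^ i) q)" for a i
    by (subst skew_mult_altdef[OF degree_monom_le])
       (simp add: if_distrib[of "\<lambda>c. Polynomial.smult c _"] if_distribR cong: if_cong)
  have Xm: "skew_X_mult \<sigma> \<delta> (monom a i) = monom (\<sigma> a) (Suc i) + monom (\<delta> a) i" for a i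
    by (rule poly_eqI)
       (auto simp: coeff_skew_X_mult sigma_derivation_simps split: nat.split)
  have "skew_mult \<sigma> \<delta> (skew_X_mult \<sigma> \<delta> (\<Sum>i\<le>degree p. monom (coeff p i) i)) q =
        skew_X_mult \<sigma> \<delta> (skew_mult \<sigma> \<delta> (\<Sum>i\<le>degree p. monom (coeff p i) i) q)"
    by (simp add: skew_X_mult_sum skew_mult_sum_left Xm skew_mult_add_left monom
                  skew_X_mult_smult)
  then show ?thesis by (simp add: poly_as_sum_of_monoms)
qed

lemma skew_mult_assoc:
  "skew_mult \<sigma> \<delta> (skew_mult \<sigma> \<delta> p q) r = skew_mult \<sigma> \<delta> p (skew_mult \<sigma> \<delta> q r)"
proof -
  have "skew_mult \<sigma> \<delta> ((skew_X_mult \<sigma> \<delta> ^^ i) q) r =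
        (skew_X_mult \<sigma> \<delta> ^^ i) (skew_mult \<sigma> \<delta> q r)" for i
    by (induction i) (auto simp: skew_mult_X_assoc)
  then show ?thesis
    by (simp add: skew_mult_def[of \<sigma> \<delta> p] skew_mult_sum_left skew_mult_smult_left)
qed

theorem ring_skew_poly_ring: "ring (skew_poly_ring \<sigma> \<delta>)"
proof (rule ringI)
  show "abelian_group (skew_poly_ring \<sigma> \<delta>)"
    by (rule abelian_groupI)
       (auto simp: skew_poly_ring_def algebra_simps intro: exI[of _ "- x" for x])
  show "monoid (skew_poly_ring \<sigma> \<delta>)"
    by (rule monoidI)
       (auto simp: skew_poly_ring_def skew_mult_assoc skew_mult_one_left skew_mult_one_right)
qed (auto simp: skew_poly_ring_def skew_mult_add_left skew_mult_add_right)

end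

section \<open>Codes over a commutative ring\<close>

definition row_vec_mult :: "'a::comm_ring_1 vec \<Rightarrow> 'a mat \<Rightarrow> 'a vec" where
  "row_vec_mult x M = vec (dim_col M) (\<lambda>j. x \<bullet> col M j)"

definition dual_code :: "nat \<Rightarrow> 'a::comm_ring_1 vec set \<Rightarrow> 'a vec set" where
  "dual_code n C = {y \<in> carrier_vec n. \<forall>x\<in>C. x \<bullet> y = 0}"

definition control_matrix :: "nat \<Rightarrow> nat \<Rightarrow> 'a::comm_ring_1 vec set \<Rightarrow> 'a mat \<Rightarrow> bool" where
  "control_matrix n t C H \<longleftrightarrow>
     t \<le> n \<and> H \<in> carrier_mat n t \<and> C = {x \<in> carrier_vec n. row_vec_mult x H = 0\<^sub>v t}"

text \<open>
  The rows of \<open>G\<close> form a basis of \<open>S\<close>.  Linear independence and span are taken in the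
  \<open>A\<close>-module \<open>A\<^sup>n\<close>; they speak about the set of rows, so distinctness is
  required separately for the rows to be independent as a family.
\<close>

definition generating_matrix :: "nat \<Rightarrow> 'a::comm_ring_1 vec set \<Rightarrow> 'a mat \<Rightarrow> bool" where
  "generating_matrix n S G \<longleftrightarrow>
     dim_col G = n \<and> distinct (rows G) \<and>
     LinearCombinations.module.lin_indpt (class_ring :: 'a ring) (module_vec TYPE('a) n) (set (rows G)) \<and>
     LinearCombinations.module.span (class_ring :: 'a ring) (module_vec TYPE('a) n) (set (rows G)) = S"

definition free_code :: "nat \<Rightarrow> nat \<Rightarrow> 'a::comm_ring_1 vec set \<Rightarrow> bool" where
  "free_code n k C \<longleftrightarrow> (\<exists>G \<in> carrier_mat k n. generating_matrix n C G)"

text \<open>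
  Parity-check matrices are defined only for free codes, so freeness of rank \<open>k\<close> is part of the
  predicate.
\<close>

definition parity_check_matrix :: "nat \<Rightarrow> nat \<Rightarrow> 'a::comm_ring_1 vec set \<Rightarrow> 'a mat \<Rightarrow> bool" where
  "parity_check_matrix n k C H \<longleftrightarrow>
     free_code n k C \<and>
     H \<in> carrier_mat (n - k) n \<and>
     control_matrix n (n - k) C (transpose_mat H) \<and>
     generating_matrix n (dual_code n C) H"

section \<open>Principal skew codes\<close>

definition vec_poly :: "'a::comm_ring_1 vec \<Rightarrow> 'a poly" where
  "vec_poly d = (\<Sum>i<dim_vec d. monom (d $ i) i)"

text \<open>
  \<open>(+) p ` left_ideal \<sigma> \<delta> f\<close> is the coset \<open>p + (f)\<^sub>l\<close>.
\<close>

definition principal_code ::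
    "('a::comm_ring_1 \<Rightarrow> 'a) \<Rightarrow> ('a \<Rightarrow> 'a) \<Rightarrow> 'a poly \<Rightarrow> 'a poly \<Rightarrow> 'a vec set" where
  "principal_code \<sigma> \<delta> f g =
     {d \<in> carrier_vec (degree f).
        (+) (vec_poly d) ` left_ideal \<sigma> \<delta> f
          \<in> {(+) p ` left_ideal \<sigma> \<delta> f | p. p \<in> left_ideal \<sigma> \<delta> g}}"

definition skew_companion :: "'a::comm_ring_1 poly \<Rightarrow> 'a mat" where
  "skew_companion f = (let n = degree f in
     mat n n (\<lambda>(i, j). if i = n - 1 then - coeff f j else if j = i + 1 then 1 else 0))"

definition skew_T ::
    "('a::comm_ring_1 \<Rightarrow> 'a) \<Rightarrow> ('a \<Rightarrow> 'a) \<Rightarrow> 'a poly \<Rightarrow> 'a vec \<Rightarrow> 'a vec" where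
  "skew_T \<sigma> \<delta> f x = row_vec_mult (map_vec \<sigma> x) (skew_companion f) + map_vec \<delta> x"

text \<open>The coefficient \<open>h\<^sub>j\<^bsup>(i)\<^esup>\<close>, for \<open>h = h\<^sub>0 + \<dots> + h\<^sub>k X\<^sup>k\<close>.\<close>

definition h_iter ::
    "('a::comm_ring_1 \<Rightarrow> 'a) \<Rightarrow> ('a \<Rightarrow> 'a) \<Rightarrow> 'a poly \<Rightarrow> nat \<Rightarrow> 'a poly \<Rightarrow> nat \<Rightarrow> nat \<Rightarrow> 'a" where
  "h_iter \<sigma> \<delta> f k h i j =
     ((skew_T \<sigma> \<delta> f ^^ i) (vec (degree f) (\<lambda>j. if j \<le> k then coeff h j else 0))) $ j"

end

theory Submission
  imports Defs
begin

text \<open>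
  The theorem rests on one observation: a polynomial \<open>d\<close> lies in \<open>(g)\<^sub>l\<close> exactly when the
  remainder of \<open>d h\<close> on right division by \<open>f\<close> has degree below \<open>k\<close> (\<open>code_iff_check\<close>).
  If \<open>d = q g\<close>, then \<open>d h = q f\<close>. Conversely, from \<open>d h = q f + r\<close> and \<open>f = g h\<close> one gets
  \<open>(d - q g) h = r\<close>; here \<open>h\<close> is monic of degree \<open>k\<close>, because \<open>\<sigma>\<^sup>n\<^sup>-\<^sup>k(h\<^sub>k)\<close> is the leading
  coefficient of \<open>f\<close>, and a nonzero left multiple of a monic polynomial of degree \<open>k\<close> has
  degree at least \<open>k\<close> (\<open>times_monic\<close>).

  The companion operator is left multiplication by \<open>X\<close> modulo \<open>(f)\<^sub>l\<close> (\<open>vec_poly_skew_T\<close>).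
  Therefore its iterates on the coefficients of \<open>h\<close> are the remainders of \<open>X\<^sup>i h\<close>, the coefficient of
  \<open>X\<^sup>k\<^sup>+\<^sup>t\<close> in the remainder of \<open>d h\<close> is the product of \<open>d\<close> with row \<open>t\<close> of the matrix, and the
  transposed matrix is a control matrix.

  The first \<open>n - k\<close> columns of the matrix form a unitriangular square: multiplying by \<open>X\<close> raises
  the degree by one, and no reduction modulo \<open>f\<close> takes place before degree \<open>n\<close> is reached. Hence
  the rows are independent, and every dual vector agrees with some combination of rows on the first
  \<open>n - k\<close> positions. The difference of the two is a dual vector supported on the last \<open>k\<close>
  positions. It is orthogonal to the codewords of \<open>g, X g, \<dots>, X\<^sup>k\<^sup>-\<^sup>1 g\<close>, whose last nonzero
  entries are ones at exactly these positions, and so it vanishes (\<open>dual_code_eq_0\<close>). Thus the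
  rows span the dual. The recurrences for the entries are the
  coordinates of the companion operator.
\<close>

section \<open>Matrices whose rows form a basis\<close>

text \<open>
  Independence of the indexed family of rows makes the rows distinct, so linear combinations over
  the set of rows are sums over row indices and both module-theoretic conditions become statements
  about coordinates.
\<close>

lemma generating_matrixI:
  fixes G :: "'a::comm_ring_1 mat"
  assumes G: "G \<in> carrier_mat m n"
    and indep: "\<And>c. (\<And>j. j < n \<Longrightarrow> (\<Sum>i<m. c i * G $$ (i, j)) = 0) \<Longrightarrow> \<forall>i<m. c i = 0"
    and span: "\<And>x. x \<in> S \<longleftrightarrow>
      x \<in> carrier_vec n \<and> (\<exists>c. \<forall>j<n. x $ j = (\<Sum>i<m. c i * G $$ (i, j)))"
  shows "generating_matrix n S G"
proof -
  interpret vec_module "TYPE('a)" n .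
  have rows_set: "set (rows G) = row G ` {..<m}"
    using G by (auto simp: rows_def)
  have inj: "inj_on (row G) {..<m}"
  proof (rule inj_onI, rule ccontr)
    fix r s assume rs: "r \<in> {..<m}" "s \<in> {..<m}" "row G r = row G s" "r \<noteq> s"
    \<comment> \<open>Two equal rows would satisfy the relation with coefficients \<open>1\<close> and \<open>- 1\<close>.\<close>
    let ?c = "\<lambda>i. (if i = r then 1 else 0) - (if i = s then 1 else (0::'a))"
    have "(\<Sum>i<m. ?c i * G $$ (i, j)) = 0" if "j < n" for j
    proof -
      have "row G r $ j = row G s $ j" using rs by simp
      then have "G $$ (r, j) = G $$ (s, j)" using rs(1,2) that G by simp
      then show ?thesis
        using rs by (simp add: left_diff_distrib sum_subtractf if_distrib[of "\<lambda>c. c * _"] cong: if_cong)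
    qed
    from indep[of ?c, OF this] rs show False by auto
  qed
  have carrier: "set (rows G) \<subseteq> carrier_vec n"
    using G by (auto simp: rows_set)
  have lincomb_carrier: "lincomb a (set (rows G)) \<in> carrier_vec n" for a
    using carrier by simp
  have lincomb_rows: "lincomb a (set (rows G)) $ j = (\<Sum>i<m. a (row G i) * G $$ (i, j))"
    if "j < n" for a j
  proof -
    have "lincomb a (set (rows G)) $ j = (\<Sum>v\<in>set (rows G). (a v \<cdot>\<^sub>v v) $ j)"
      unfolding lincomb_def using carrier that by (intro finsum_index) auto
    also have "\<dots> = (\<Sum>i<m. (a (row G i) \<cdot>\<^sub>v row G i) $ j)"
      unfolding rows_set by (simp add: sum.reindex[OF inj])
    also have "\<dots> = (\<Sum>i<m. a (row G i) * G $$ (i, j))"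
      by (rule sum.cong) (use G that in auto)
    finally show ?thesis .
  qed
  have "distinct (rows G)"
    using inj G by (auto simp: rows_def distinct_map atLeast0LessThan)
  moreover have "lin_indpt (set (rows G))"
  proof
    assume "lin_dep (set (rows G))"
    from finite_lin_dep[OF _ this] carrier obtain a v where
      zero: "lincomb a (set (rows G)) = 0\<^sub>v n" and v: "v \<in> set (rows G)" "a v \<noteq> 0"
      by auto
    have "\<forall>i<m. a (row G i) = 0"
      by (rule indep) (use lincomb_rows[of _ a] zero in auto)
    with v show False by (auto simp: rows_set)
  qed
  moreover have "span (set (rows G)) = S"
  proof (intro equalityI subsetI)
    fix x assume "x \<in> span (set (rows G))"
    then obtain a where "x = lincomb a (set (rows G))"
      using finite_span[OF _ carrier] by auto
    then show "x \<in> S"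
      using lincomb_rows[of _ a] lincomb_carrier[of a]
      by (auto simp: span intro!: exI[of _ "\<lambda>i. a (row G i)"])
  next
    fix x assume "x \<in> S"
    then obtain c where x: "x \<in> carrier_vec n" "\<forall>j<n. x $ j = (\<Sum>i<m. c i * G $$ (i, j))"
      by (auto simp: span)
    define a where "a = (\<lambda>v. c (inv_into {..<m} (row G) v))"
    have "lincomb a (set (rows G)) = x"
    proof (rule eq_vecI)
      show "lincomb a (set (rows G)) $ j = x $ j" if "j < dim_vec x" for j
        using that x lincomb_rows[of j a] inj by (auto simp: a_def intro!: sum.cong)
    qed (use x lincomb_carrier[of a] in auto)
    then show "x \<in> span (set (rows G))"
      using finite_span[OF _ carrier] by auto
  qed
  ultimately show ?thesis
    using G by (auto simp: generating_matrix_def)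
qed

text \<open>
  Forward substitution: the last coefficient does not disturb the earlier equations, because
  the row it multiplies starts only at the last column.
\<close>

lemma unitriangular_solve:
  fixes U :: "nat \<Rightarrow> nat \<Rightarrow> 'a::comm_ring_1"
  assumes "\<And>i j. j < i \<Longrightarrow> i < m \<Longrightarrow> U i j = 0" and "\<And>i. i < m \<Longrightarrow> U i i = 1"
  shows "\<exists>c. \<forall>j<m. (\<Sum>i<m. c i * U i j) = y j"
  using assms
proof (induction m)
  case (Suc m)
  then obtain c where c: "\<forall>j<m. (\<Sum>i<m. c i * U i j) = y j"
    by (meson less_Suc_eq)
  define c' where "c' = c(m := y m - (\<Sum>i<m. c i * U i m))"
  have "(\<Sum>i<m. c' i * U i j) = (\<Sum>i<m. c i * U i j)" for j
    by (rule sum.cong) (auto simp: c'_def)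
  then have "(\<Sum>i<Suc m. c' i * U i j) = y j" if "j < Suc m" for j
    using c Suc.prems that by (cases "j = m") (auto simp: c'_def)
  then show ?case by blast
qed simp

lemma unitriangular_independent:
  fixes U :: "nat \<Rightarrow> nat \<Rightarrow> 'a::comm_ring_1"
  assumes zero: "\<And>i j. j < i \<Longrightarrow> i < m \<Longrightarrow> U i j = 0" and one: "\<And>i. i < m \<Longrightarrow> U i i = 1"
    and rel: "\<And>j. j < m \<Longrightarrow> (\<Sum>i<m. c i * U i j) = 0"
  shows "\<forall>i<m. c i = 0"
proof (intro allI impI)
  fix t assume "t < m"
  then show "c t = 0"
  proof (induction t rule: less_induct)
    case (less t)
    have "0 = (\<Sum>i<m. c i * U i t)" using rel less.prems by simp
    also have "\<dots> = (\<Sum>i<m. if i = t then c t else 0)"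
    proof (rule sum.cong)
      fix i assume "i \<in> {..<m}"
      then show "c i * U i t = (if i = t then c t else 0)"
        using less zero[of t i] one[of t] by (cases i t rule: linorder_cases) auto
    qed simp
    also have "\<dots> = c t" using less.prems by simp
    finally show ?case by simp
  qed
qed

section \<open>Vectors as polynomials of bounded degree\<close>

lemma coeff_vec_poly: "coeff (vec_poly d) j = (if j < dim_vec d then d $ j else 0)"
  by (simp add: vec_poly_def coeff_sum)

lemma degree_vec_poly: "0 < dim_vec d \<Longrightarrow> degree (vec_poly d) < dim_vec d"
  by (rule degree_lessI) (auto simp: coeff_vec_poly)

lemma vec_poly_coeffs:
  assumes "degree p < n"
  shows "vec_poly (vec n (coeff p)) = p"
  using assms by (intro poly_eqI) (auto simp: coeff_vec_poly coeff_eq_0)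

lemma skew_mult_vec_poly:
  assumes "0 < dim_vec d"
  shows "skew_mult \<sigma> \<delta> (vec_poly d) q =
    (\<Sum>i<dim_vec d. Polynomial.smult (d $ i) ((skew_X_mult \<sigma> \<delta> ^^ i) q))"
proof -
  have "{..dim_vec d - 1} = {..<dim_vec d}" using assms by auto
  then show ?thesis
    using degree_vec_poly[OF assms]
    by (subst skew_mult_altdef[where N = "dim_vec d - 1"]) (auto simp: coeff_vec_poly)
qed

section \<open>Degrees of skew products\<close>

locale skew_polynomials = comm_ring_isom \<sigma>
  for \<sigma> :: "'a::comm_ring_1 \<Rightarrow> 'a" +
  fixes \<delta> :: "'a \<Rightarrow> 'a"
  assumes derivation: "sigma_derivation \<sigma> \<delta>"
begin

abbreviation X_times :: "'a poly \<Rightarrow> 'a poly" where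
  "X_times \<equiv> skew_X_mult \<sigma> \<delta>"

abbreviation times_skew :: "'a poly \<Rightarrow> 'a poly \<Rightarrow> 'a poly" (infixl \<open>\<star>\<close> 70) where
  "p \<star> q \<equiv> skew_mult \<sigma> \<delta> p q"

lemmas delta_simps = sigma_derivation_simps[OF comm_ring_isom_axioms derivation]
lemmas coeff_X_times = coeff_skew_X_mult[OF comm_ring_isom_axioms derivation]
lemmas X_times_add = skew_X_mult_add[OF comm_ring_isom_axioms derivation]
lemmas X_times_assoc = skew_mult_X_assoc[OF comm_ring_isom_axioms derivation]
lemmas times_assoc = skew_mult_assoc[OF comm_ring_isom_axioms derivation]

lemma times_minus_left: "(p - q) \<star> r = p \<star> r - q \<star> r"
  using skew_mult_add_left[of \<sigma> \<delta> "p - q" q r] by (simp add: algebra_simps)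

lemma coeff_X_pow_above:
  assumes "degree q \<le> d" and "d + i < j"
  shows "coeff ((X_times ^^ i) q) j = 0"
  using assms(2)
proof (induction i arbitrary: j)
  case 0
  then show ?case using assms(1) by (simp add: coeff_eq_0)
next
  case (Suc i)
  then obtain j' where "j = Suc j'" by (cases j) auto
  with Suc show ?case by (simp add: coeff_X_times delta_simps)
qed

lemma coeff_X_pow_top:
  assumes "degree q \<le> d"
  shows "coeff ((X_times ^^ i) q) (d + i) = (\<sigma> ^^ i) (coeff q d)"
proof (induction i)
  case (Suc i)
  then show ?case
    using coeff_X_pow_above[OF assms, of i "Suc (d + i)"] by (simp add: coeff_X_times delta_simps)
qed simp

lemma degree_times_le: "degree (p \<star> q) \<le> degree p + degree q"
proof (rule degree_le, intro allI impI)
  fix j assume "degree p + degree q < j"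
  then show "coeff (p \<star> q) j = 0"
    by (auto simp: skew_mult_def coeff_sum coeff_X_pow_above[of q "degree q"] intro!: sum.neutral)
qed

lemma coeff_times_top:
  assumes p: "degree p \<le> m" and q: "degree q \<le> d"
  shows "coeff (p \<star> q) (d + m) = coeff p m * (\<sigma> ^^ m) (coeff q d)"
proof -
  have "coeff (p \<star> q) (d + m) = (\<Sum>i\<le>m. coeff p i * coeff ((X_times ^^ i) q) (d + m))"
    by (simp add: skew_mult_altdef[OF p] coeff_sum)
  also have "\<dots> = (\<Sum>i\<le>m. if i = m then coeff p m * (\<sigma> ^^ m) (coeff q d) else 0)"
    by (rule sum.cong) (auto simp: coeff_X_pow_above[OF q] coeff_X_pow_top[OF q])
  finally show ?thesis by simp
qed

lemma sigma_pow_one: "(\<sigma> ^^ i) 1 = 1"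
  by (induction i) simp_all

lemma sigma_pow_eq_one_iff: "(\<sigma> ^^ i) a = 1 \<longleftrightarrow> a = 1"
  by (induction i) simp_all

text \<open>
  Multiplication by a monic polynomial on the right multiplies leading coefficients by
  \<open>\<sigma>\<^sup>m(1) = 1\<close>, so it adds degrees even over a ring with zero divisors.
\<close>

lemma times_monic:
  assumes "lead_coeff m = 1" and "p \<noteq> 0"
  shows "p \<star> m \<noteq> 0" and "degree (p \<star> m) = degree p + degree m"
proof -
  have top: "coeff (p \<star> m) (degree m + degree p) \<noteq> 0"
    using assms by (simp add: coeff_times_top sigma_pow_one)
  then show "p \<star> m \<noteq> 0" by auto
  show "degree (p \<star> m) = degree p + degree m"
    using le_degree[OF top] degree_times_le[of p m] by simp
qed

section \<open>The operator of a companion matrix as multiplication by X\<close>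

lemma skew_T_carrier:
  assumes "x \<in> carrier_vec (degree f)"
  shows "skew_T \<sigma> \<delta> f x \<in> carrier_vec (degree f)"
  using assms by (intro carrier_vecI) (auto simp: skew_T_def)

lemma skew_T_pow_carrier:
  assumes "x \<in> carrier_vec (degree f)"
  shows "(skew_T \<sigma> \<delta> f ^^ i) x \<in> carrier_vec (degree f)"
  using assms by (induction i) (auto intro: skew_T_carrier)

lemma skew_T_index:
  assumes x: "x \<in> carrier_vec (degree f)" and j: "j < degree f"
  shows "skew_T \<sigma> \<delta> f x $ j =
    \<delta> (x $ j) + (if j = 0 then 0 else \<sigma> (x $ (j - 1))) - coeff f j * \<sigma> (x $ (degree f - 1))"
proof -
  let ?n = "degree f"
  let ?last = "- coeff f j * \<sigma> (x $ (?n - 1))"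
  let ?shift = "if j = 0 then 0 else \<sigma> (x $ (j - 1))"
  \<comment> \<open>The last row of the companion matrix contributes the coefficient of \<open>f\<close>, the others shift.\<close>
  have split: "{0..<?n} = insert (?n - 1) {0..<?n - 1}" using j by auto
  have "row_vec_mult (map_vec \<sigma> x) (skew_companion f) $ j =
      (\<Sum>i\<in>{0..<?n}. \<sigma> (x $ i) *
        (if i = ?n - 1 then - coeff f j else if j = i + 1 then 1 else 0))"
    using x j by (auto simp: row_vec_mult_def skew_companion_def scalar_prod_def Let_def intro!: sum.cong)
  also have "\<dots> = ?last + (\<Sum>i\<in>{0..<?n - 1}. \<sigma> (x $ i) * (if j = i + 1 then 1 else 0))"
    unfolding split by (subst sum.insert) (auto intro!: sum.cong)
  also have "(\<Sum>i\<in>{0..<?n - 1}. \<sigma> (x $ i) * (if j = i + 1 then 1 else 0)) =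
      (\<Sum>i\<in>{0..<?n - 1}. if i = j - 1 then ?shift else 0)"
    by (rule sum.cong) auto
  also have "\<dots> = ?shift" using j by auto
  finally have "row_vec_mult (map_vec \<sigma> x) (skew_companion f) $ j = ?last + ?shift" .
  moreover have "dim_vec (row_vec_mult (map_vec \<sigma> x) (skew_companion f)) = ?n"
    by (simp add: row_vec_mult_def skew_companion_def Let_def)
  ultimately show ?thesis using x j by (simp add: skew_T_def)
qed

text \<open>
  For a polynomial \<open>p\<close> of degree below \<open>n\<close>, the product \<open>X p\<close> has degree at most \<open>n\<close>;
  subtracting the multiple of the monic \<open>f\<close> that cancels its \<open>X\<^sup>n\<close>-term reduces it modulo
  \<open>(f)\<^sub>l\<close>.  On coordinates this reduction is the operator of the companion matrix.
\<close>

lemma vec_poly_skew_T: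
  assumes monic: "lead_coeff f = 1" and n: "0 < degree f" and x: "x \<in> carrier_vec (degree f)"
  shows "vec_poly (skew_T \<sigma> \<delta> f x) =
    X_times (vec_poly x) - Polynomial.smult (\<sigma> (x $ (degree f - 1))) f"
proof (rule poly_eqI)
  fix j
  consider "j < degree f" | "j = degree f" | "j > degree f" by linarith
  then show "coeff (vec_poly (skew_T \<sigma> \<delta> f x)) j =
    coeff (X_times (vec_poly x) - Polynomial.smult (\<sigma> (x $ (degree f - 1))) f) j"
  proof cases
    case 1
    then show ?thesis
      using x skew_T_carrier[OF x] skew_T_index[OF x, of j]
      by (auto simp: coeff_vec_poly coeff_X_times algebra_simps split: nat.split)
  next
    case 2
    then show ?thesis
      using x skew_T_carrier[OF x] monic n
      by (auto simp: coeff_vec_poly coeff_X_times delta_simps split: nat.split)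
  next
    case 3
    then show ?thesis
      using x skew_T_carrier[OF x]
      by (auto simp: coeff_vec_poly coeff_X_times delta_simps coeff_eq_0 split: nat.split)
  qed
qed

lemma vec_poly_skew_T_pow:
  assumes monic: "lead_coeff f = 1" and n: "0 < degree f" and x: "x \<in> carrier_vec (degree f)"
  shows "\<exists>q. (X_times ^^ i) (vec_poly x) = q \<star> f + vec_poly ((skew_T \<sigma> \<delta> f ^^ i) x)"
proof (induction i)
  case 0
  show ?case by (auto intro: exI[of _ 0] simp: skew_mult_zero_left)
next
  case (Suc i)
  then obtain q where q: "(X_times ^^ i) (vec_poly x) = q \<star> f + vec_poly ((skew_T \<sigma> \<delta> f ^^ i) x)"
    by blast
  let ?y = "(skew_T \<sigma> \<delta> f ^^ i) x"
  let ?c = "\<sigma> (?y $ (degree f - 1))"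
  have "(X_times ^^ Suc i) (vec_poly x) = X_times q \<star> f + X_times (vec_poly ?y)"
    by (simp add: q X_times_add X_times_assoc)
  also have "\<dots> = (X_times q + [:?c:]) \<star> f + vec_poly ((skew_T \<sigma> \<delta> f ^^ Suc i) x)"
    using vec_poly_skew_T[OF monic n skew_T_pow_carrier[OF x]]
    by (simp add: skew_mult_add_left skew_mult_const_left)
  finally show ?case by blast
qed

end

section \<open>Codes whose generator is a left factor\<close>

locale skew_code = skew_polynomials \<sigma> \<delta>
  for \<sigma> \<delta> :: "'a::comm_ring_1 \<Rightarrow> 'a" +
  fixes f g h :: "'a poly" and n k :: nat
  assumes degree_f: "degree f = n" and monic_f: "lead_coeff f = 1"
    and k_less: "k < n"
    and degree_g: "degree g = n - k" and monic_g: "lead_coeff g = 1"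
    and right_div: "right_divisor \<sigma> \<delta> g f"
    and degree_h_le: "degree h \<le> k"
    and f_eq: "f = g \<star> h"
begin

abbreviation code :: "'a vec set" where
  "code \<equiv> principal_code \<sigma> \<delta> f g"

abbreviation hi :: "nat \<Rightarrow> nat \<Rightarrow> 'a" where
  "hi \<equiv> h_iter \<sigma> \<delta> f k h"

abbreviation h_vec :: "'a vec" where
  "h_vec \<equiv> vec n (\<lambda>j. if j \<le> k then coeff h j else 0)"

text \<open>
  Comparing coefficients of \<open>X\<^sup>n\<close> in \<open>f = g h\<close> gives \<open>\<sigma>\<^sup>n\<^sup>-\<^sup>k(h\<^sub>k) = 1\<close>.
\<close>

lemma coeff_h_k: "coeff h k = 1"
proof -
  have "coeff f n = coeff g (n - k) * (\<sigma> ^^ (n - k)) (coeff h k)"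
    using coeff_times_top[of g "n - k" h k] degree_g degree_h_le k_less
    by (simp add: f_eq[symmetric])
  then have "(\<sigma> ^^ (n - k)) (coeff h k) = 1"
    using monic_f monic_g degree_f degree_g by simp
  then show ?thesis by (simp add: sigma_pow_eq_one_iff)
qed

lemma degree_h: "degree h = k"
  using degree_h_le le_degree[of h k] coeff_h_k by simp

subsection \<open>The iterates of the coefficients of h\<close>

lemma hi_def: "hi i j = (skew_T \<sigma> \<delta> f ^^ i) h_vec $ j"
  by (simp add: h_iter_def degree_f)

lemma hi_carrier: "(skew_T \<sigma> \<delta> f ^^ i) h_vec \<in> carrier_vec n"
  using skew_T_pow_carrier[of h_vec f i] degree_f by simp

lemma hi_0: "j < n \<Longrightarrow> hi 0 j = (if j \<le> k then coeff h j else 0)"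
  by (simp add: hi_def)

lemma hi_Suc:
  assumes "j < n"
  shows "hi (Suc i) j =
    \<delta> (hi i j) + (if j = 0 then 0 else \<sigma> (hi i (j - 1))) - coeff f j * \<sigma> (hi i (n - 1))"
  using skew_T_index[of "(skew_T \<sigma> \<delta> f ^^ i) h_vec" f j] assms hi_carrier[of i]
  by (simp add: hi_def degree_f)

text \<open>
  Each application of the operator raises the degree by one, and no reduction modulo \<open>f\<close>
  takes place as long as the top coordinate \<open>n - 1\<close> is still zero.
\<close>

lemma hi_above:
  assumes "k + i < j" and "j < n"
  shows "hi i j = 0"
  using assms
proof (induction i arbitrary: j)
  case 0
  then show ?case by (simp add: hi_0)
next
  case (Suc i)
  then show ?case by (simp add: hi_Suc delta_simps)
qed

lemma hi_diagonal:
  assumes "k + i < n"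
  shows "hi i (k + i) = (\<sigma> ^^ i) (coeff h k)"
  using assms
proof (induction i)
  case 0
  then show ?case by (simp add: hi_0)
next
  case (Suc i)
  then show ?case
    using hi_above[of i "n - 1"] hi_above[of i "k + Suc i"] by (simp add: hi_Suc delta_simps)
qed

lemma hi_diagonal_one: "k + i < n \<Longrightarrow> hi i (k + i) = 1"
  by (simp add: hi_diagonal coeff_h_k sigma_pow_one)

subsection \<open>Checking membership\<close>

text \<open>
  As \<open>f\<close> is a left multiple of \<open>g\<close>, the ideal \<open>(f)\<^sub>l\<close> lies in \<open>(g)\<^sub>l\<close>, and membership of a
  coset can be tested on any representative.
\<close>

lemma code_iff: "d \<in> code \<longleftrightarrow> d \<in> carrier_vec n \<and> (\<exists>q. vec_poly d = q \<star> g)"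
proof -
  obtain f' where f': "f = f' \<star> g"
    using right_div by (auto simp: right_divisor_def)
  have "(\<exists>q. p = q \<star> g)"
    if eq: "(+) p ` left_ideal \<sigma> \<delta> f = (+) (q \<star> g) ` left_ideal \<sigma> \<delta> f" for p q
  proof -
    have "0 \<in> left_ideal \<sigma> \<delta> f"
      by (auto simp: left_ideal_def intro!: exI[of _ 0] simp: skew_mult_zero_left)
    then have "p \<in> (+) p ` left_ideal \<sigma> \<delta> f" by (auto intro!: image_eqI[of _ _ 0])
    then obtain r where "p = q \<star> g + r \<star> f"
      unfolding eq by (auto simp: left_ideal_def)
    also have "\<dots> = (q + r \<star> f') \<star> g"
      by (subst f') (simp add: skew_mult_add_left times_assoc)
    finally show ?thesis by blast
  qed
  then show ?thesis
    by (auto simp: principal_code_def left_ideal_def degree_f)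
qed

lemma code_carrier: "d \<in> code \<Longrightarrow> d \<in> carrier_vec n"
  by (simp add: code_iff)

text \<open>
  As \<open>X\<^sup>i h\<close> is congruent to \<open>\<Sum>\<^sub>j h\<^sub>j\<^sup>(\<^sup>i\<^sup>) X\<^sup>j\<close> modulo \<open>(f)\<^sub>l\<close>, the same
  combination of these polynomials is the remainder of \<open>d h\<close> modulo \<open>f\<close>.
\<close>

lemma times_h_remainder:
  assumes d: "d \<in> carrier_vec n"
  shows "\<exists>q. vec_poly d \<star> h = q \<star> f + vec_poly (vec n (\<lambda>j. \<Sum>i<n. d $ i * hi i j))"
proof -
  have h_vec: "vec_poly h_vec = h"
    using degree_h k_less by (intro poly_eqI) (auto simp: coeff_vec_poly coeff_eq_0)
  have "\<forall>i. \<exists>q. (X_times ^^ i) h = q \<star> f + vec_poly ((skew_T \<sigma> \<delta> f ^^ i) h_vec)"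
    using vec_poly_skew_T_pow[OF monic_f, of h_vec] degree_f k_less h_vec by simp
  then obtain q where q: "\<And>i. (X_times ^^ i) h = q i \<star> f + vec_poly ((skew_T \<sigma> \<delta> f ^^ i) h_vec)"
    by metis
  have remainder: "(\<Sum>i<n. Polynomial.smult (d $ i) (vec_poly ((skew_T \<sigma> \<delta> f ^^ i) h_vec))) =
      vec_poly (vec n (\<lambda>j. \<Sum>i<n. d $ i * hi i j))"
    using carrier_vecD[OF hi_carrier] by (intro poly_eqI) (auto simp: coeff_sum coeff_vec_poly hi_def)
  have "vec_poly d \<star> h = (\<Sum>i<n. Polynomial.smult (d $ i) ((X_times ^^ i) h))"
    using d k_less by (simp add: skew_mult_vec_poly)
  also have "\<dots> = (\<Sum>i<n. Polynomial.smult (d $ i) (q i)) \<star> f +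
      vec_poly (vec n (\<lambda>j. \<Sum>i<n. d $ i * hi i j))"
    by (simp add: q smult_add_right sum.distrib remainder skew_mult_sum_left skew_mult_smult_left)
  finally show ?thesis by blast
qed

text \<open>
  A multiple \<open>q g\<close> of the generator satisfies \<open>q g h = q f\<close>, which leaves remainder \<open>0\<close>.
  Conversely, if \<open>d h = q f + r\<close> with \<open>deg r < k\<close>, then \<open>(d - q g) h = r\<close>, and since \<open>h\<close> is
  monic of degree \<open>k\<close> this forces \<open>d = q g\<close>.  So only the coordinates \<open>k, \<dots>, n - 1\<close> of the
  remainder have to be tested.
\<close>

lemma code_iff_check:
  "d \<in> code \<longleftrightarrow> d \<in> carrier_vec n \<and> (\<forall>t<n - k. (\<Sum>i<n. d $ i * hi i (k + t)) = 0)"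
proof (cases "d \<in> carrier_vec n")
  case d: True
  define r where "r = vec_poly (vec n (\<lambda>j. \<Sum>i<n. d $ i * hi i j))"
  obtain q where q: "vec_poly d \<star> h = q \<star> f + r"
    using times_h_remainder[OF d] by (auto simp: r_def)
  have coeff_r: "coeff r j = (if j < n then \<Sum>i<n. d $ i * hi i j else 0)" for j
    by (simp add: r_def coeff_vec_poly)
  have "degree r < n"
    unfolding r_def using degree_vec_poly[of "vec n (\<lambda>j. \<Sum>i<n. d $ i * hi i j)"] k_less by simp
  have "(\<exists>q. vec_poly d = q \<star> g) \<longleftrightarrow>
      (\<forall>t<n - k. coeff r (k + t) = 0)"
  proof
    assume "\<exists>q. vec_poly d = q \<star> g"
    then obtain p where "vec_poly d = p \<star> g" by blast
    then have "r = (p - q) \<star> f"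
      using q by (simp add: times_assoc f_eq[symmetric] times_minus_left)
    \<comment> \<open>A nonzero left multiple of the monic \<open>f\<close> would have degree at least \<open>n\<close>.\<close>
    then have "r = 0"
      using times_monic(2)[OF monic_f, of "p - q"] \<open>degree r < n\<close> degree_f
      by (cases "p = q") (auto simp: skew_mult_zero_left)
    then show "\<forall>t<n - k. coeff r (k + t) = 0" by simp
  next
    assume top: "\<forall>t<n - k. coeff r (k + t) = 0"
    have top': "coeff r j = 0" if "j \<ge> k" for j
      using top[rule_format, of "j - k"] that by (cases "j < n") (auto simp: coeff_r)
    have "(vec_poly d - q \<star> g) \<star> h = r"
      using q by (simp add: times_minus_left times_assoc f_eq[symmetric])
    then have "vec_poly d - q \<star> g = 0"
      using times_monic[of h "vec_poly d - q \<star> g"] degree_h coeff_h_k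
        top'[of "degree r"] by auto
    then show "\<exists>q. vec_poly d = q \<star> g" by auto
  qed
  with d show ?thesis by (auto simp: code_iff coeff_r)
qed (simp add: code_iff)

subsection \<open>Bases of the code and of its dual\<close>

text \<open>
  Since \<open>g\<close> is monic, a nonzero \<open>q g\<close> has degree below \<open>n\<close> exactly when \<open>deg q < k\<close>, and
  \<open>q g = 0\<close> only for \<open>q = 0\<close>. So \<open>g, X g, \<dots>, X\<^sup>k\<^sup>-\<^sup>1 g\<close> is a basis of the code.
\<close>

lemma free_code_code: "free_code n k code"
proof -
  define G where "G = mat k n (\<lambda>(i, j). coeff ((X_times ^^ i) g) j)"
  have G: "G \<in> carrier_mat k n" by (simp add: G_def)
  define p where "p c = (\<Sum>i<k. monom (c i) i)" for c :: "nat \<Rightarrow> 'a"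
  have coeff_p: "coeff (p c) i = (if i < k then c i else 0)" for c i
    by (simp add: p_def coeff_sum)
  have times_p: "p c \<star> g = (\<Sum>i<k. Polynomial.smult (c i) ((X_times ^^ i) g))" for c
  proof -
    have "degree (p c) \<le> k"
      by (rule degree_le) (simp add: coeff_p)
    then have "p c \<star> g = (\<Sum>i\<le>k. Polynomial.smult (coeff (p c) i) ((X_times ^^ i) g))"
      by (rule skew_mult_altdef)
    then show ?thesis
      by (simp add: coeff_p lessThan_Suc_atMost[symmetric])
  qed
  have comb: "(\<Sum>i<k. c i * G $$ (i, j)) = coeff (p c \<star> g) j" if "j < n" for c j
    using that by (simp add: times_p G_def coeff_sum)
  have above: "coeff (p c \<star> g) j = 0" if "j \<ge> n" for c j
    using that degree_g k_less
    by (auto simp: times_p coeff_sum coeff_X_pow_above[of g "n - k"] intro!: sum.neutral)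
  have "generating_matrix n code G"
  proof (rule generating_matrixI[OF G])
    fix c assume "\<And>j. j < n \<Longrightarrow> (\<Sum>i<k. c i * G $$ (i, j)) = 0"
    then have "p c \<star> g = 0"
      using comb above by (intro poly_eqI) (metis coeff_0 not_less)
    then have "p c = 0" using times_monic(1)[OF monic_g] by blast
    then show "\<forall>i<k. c i = 0" using coeff_p by (metis coeff_0)
  next
    fix x
    have "(\<exists>q. vec_poly x = q \<star> g) \<longleftrightarrow> (\<exists>c. \<forall>j<n. x $ j = (\<Sum>i<k. c i * G $$ (i, j)))"
      if x: "x \<in> carrier_vec n"
    proof
      assume "\<exists>q. vec_poly x = q \<star> g"
      then obtain q where q: "vec_poly x = q \<star> g" by blast
      have "degree (vec_poly x) < n" using x k_less degree_vec_poly[of x] by simp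
      then have "q = 0 \<or> degree q < k"
        using times_monic(2)[OF monic_g, of q] q degree_g by (cases "q = 0") auto
      then have "q = p (coeff q)"
        by (intro poly_eqI) (auto simp: coeff_p coeff_eq_0)
      with q have "vec_poly x = p (coeff q) \<star> g" by simp
      then have "x $ j = (\<Sum>i<k. coeff q i * G $$ (i, j))" if "j < n" for j
        using coeff_vec_poly[of x j] comb[OF that, of "coeff q"] x that by simp
      then show "\<exists>c. \<forall>j<n. x $ j = (\<Sum>i<k. c i * G $$ (i, j))" by blast
    next
      assume "\<exists>c. \<forall>j<n. x $ j = (\<Sum>i<k. c i * G $$ (i, j))"
      then obtain c where "\<forall>j<n. x $ j = (\<Sum>i<k. c i * G $$ (i, j))" by blast
      then have "vec_poly x = p c \<star> g"
        using x comb above by (intro poly_eqI) (auto simp: coeff_vec_poly)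
      then show "\<exists>q. vec_poly x = q \<star> g" by blast
    qed
    then show "x \<in> code \<longleftrightarrow>
        x \<in> carrier_vec n \<and> (\<exists>c. \<forall>j<n. x $ j = (\<Sum>i<k. c i * G $$ (i, j)))"
      by (auto simp: code_iff)
  qed
  with G show ?thesis by (auto simp: free_code_def)
qed

definition check :: "'a mat" where
  "check = mat (n - k) n (\<lambda>(t, i). hi i (k + t))"

lemma check_carrier: "check \<in> carrier_mat (n - k) n"
  by (simp add: check_def)

lemma check_unitriangular:
  assumes "t < n - k"
  shows "i < t \<Longrightarrow> check $$ (t, i) = 0" and "check $$ (t, t) = 1"
  using assms by (auto simp: check_def hi_above hi_diagonal_one)

lemma control_matrix_check: "control_matrix n (n - k) code (transpose_mat check)"
proof -
  have "row_vec_mult x (transpose_mat check) = 0\<^sub>v (n - k) \<longleftrightarrow>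
      (\<forall>t<n - k. (\<Sum>i<n. x $ i * hi i (k + t)) = 0)" if "x \<in> carrier_vec n" for x
  proof -
    have "x \<bullet> row check t = (\<Sum>i<n. x $ i * hi i (k + t))" if "t < n - k" for t
      using that check_carrier
      by (auto simp: scalar_prod_def check_def atLeast0LessThan intro!: sum.cong)
    then show ?thesis
      using check_carrier by (auto simp: row_vec_mult_def vec_eq_iff)
  qed
  then show ?thesis
    using check_carrier by (auto simp: control_matrix_def code_iff_check)
qed

text \<open>
  The codeword of \<open>X\<^sup>i g\<close> ends with a \<open>1\<close> at position \<open>n - k + i\<close>.  So a dual vector supported on
  the last \<open>k\<close> positions vanishes there one position after the other.
\<close>

lemma dual_code_eq_0:
  assumes y: "y \<in> dual_code n code" and init: "\<And>j. j < n - k \<Longrightarrow> y $ j = 0" and j: "j < n"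
  shows "y $ j = 0"
  using j
proof (induction j rule: less_induct)
  case (less j)
  show ?case
  proof (cases "j < n - k")
    case False
    define i where "i = j - (n - k)"
    let ?p = "(X_times ^^ i) g"
    define x where "x = vec n (coeff ?p)"
    have above: "coeff ?p l = 0" if "j < l" for l
      using coeff_X_pow_above[of g "n - k" i l] that degree_g False by (simp add: i_def)
    have top: "coeff ?p j = 1"
      using coeff_X_pow_top[of g "n - k" i] degree_g monic_g False
      by (simp add: i_def sigma_pow_one)
    have "degree ?p < n"
      using above less.prems degree_le[of j ?p] by simp
    moreover have "?p = monom 1 i \<star> g"
      by (subst skew_mult_altdef[OF degree_monom_le])
         (simp add: if_distrib[of "\<lambda>c. Polynomial.smult c _"] if_distribR cong: if_cong)
    ultimately have "x \<in> code"
      by (auto simp: code_iff x_def vec_poly_coeffs)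
    with y have "0 = x \<bullet> y" by (auto simp: dual_code_def)
    also have "\<dots> = (\<Sum>l<n. coeff ?p l * y $ l)"
      using y by (auto simp: scalar_prod_def x_def dual_code_def atLeast0LessThan)
    also have "\<dots> = (\<Sum>l<n. if l = j then y $ j else 0)"
    proof (rule sum.cong)
      fix l assume "l \<in> {..<n}"
      then show "coeff ?p l * y $ l = (if l = j then y $ j else 0)"
        using less above top by (cases l j rule: linorder_cases) auto
    qed simp
    finally show ?thesis using less.prems by simp
  qed (rule init)
qed

text \<open>
  Given a dual vector, a combination of the unitriangular rows matches its first \<open>n - k\<close>
  coordinates, and the difference, again in the dual, then vanishes altogether.
\<close>

lemma generating_matrix_check: "generating_matrix n (dual_code n code) check"
proof (rule generating_matrixI[OF check_carrier])
  fix c assume "\<And>j. j < n \<Longrightarrow> (\<Sum>i<n - k. c i * check $$ (i, j)) = 0"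
  then show "\<forall>i<n - k. c i = 0"
    by (intro unitriangular_independent[of "n - k" "\<lambda>i j. check $$ (i, j)"])
       (auto simp: check_unitriangular)
next
  fix y
  define comb where "comb c = vec n (\<lambda>j. \<Sum>i<n - k. c i * check $$ (i, j))" for c
  have comb_dual: "comb c \<in> dual_code n code" for c
  proof -
    have "x \<bullet> comb c = 0" if "x \<in> code" for x
    proof -
      have "x \<bullet> comb c = (\<Sum>j<n. \<Sum>i<n - k. c i * (x $ j * hi j (k + i)))"
        by (auto simp: scalar_prod_def comb_def check_def atLeast0LessThan sum_distrib_left
              mult.left_commute intro!: sum.cong)
      also have "\<dots> = (\<Sum>i<n - k. c i * (\<Sum>j<n. x $ j * hi j (k + i)))"
        by (subst sum.swap) (simp add: sum_distrib_left)
      also have "\<dots> = 0" using that by (simp add: code_iff_check)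
      finally show ?thesis .
    qed
    then show ?thesis by (auto simp: dual_code_def comb_def)
  qed
  show "y \<in> dual_code n code \<longleftrightarrow>
      y \<in> carrier_vec n \<and> (\<exists>c. \<forall>j<n. y $ j = (\<Sum>i<n - k. c i * check $$ (i, j)))"
  proof safe
    assume y: "y \<in> dual_code n code"
    then show carrier: "y \<in> carrier_vec n" by (simp add: dual_code_def)
    obtain c where c: "\<forall>j<n - k. (\<Sum>i<n - k. c i * check $$ (i, j)) = y $ j"
      using unitriangular_solve[of "n - k" "\<lambda>i j. check $$ (i, j)"] check_unitriangular by blast
    have "x \<bullet> (y - comb c) = 0" if "x \<in> code" for x
      using y comb_dual[of c] that scalar_prod_minus_distrib[OF code_carrier[OF that], of y "comb c"]
      by (simp add: dual_code_def)
    then have "y - comb c \<in> dual_code n code"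
      using carrier by (simp add: dual_code_def comb_def)
    then have "(y - comb c) $ j = 0" if "j < n" for j
      by (rule dual_code_eq_0) (use c carrier that in \<open>auto simp: comb_def\<close>)
    then show "\<exists>c. \<forall>j<n. y $ j = (\<Sum>i<n - k. c i * check $$ (i, j))"
      using carrier by (auto simp: comb_def intro!: exI[of _ c])
  next
    fix c assume "y \<in> carrier_vec n" "\<forall>j<n. y $ j = (\<Sum>i<n - k. c i * check $$ (i, j))"
    then have "y = comb c" by (auto simp: comb_def)
    then show "y \<in> dual_code n code" by (simp add: comb_dual)
  qed
qed

lemma parity_check_matrix_check: "parity_check_matrix n k code check"
  by (simp add: parity_check_matrix_def free_code_code check_carrier control_matrix_check
      generating_matrix_check)

end

section \<open>The parity-check matrix\<close>

theorem theorem6p1: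
  fixes \<sigma> \<delta> :: "'a::{comm_ring_1, finite} \<Rightarrow> 'a"
    and f g h :: "'a poly" and n k :: nat
  assumes "comm_ring_isom \<sigma>"
    and "sigma_derivation \<sigma> \<delta>"
    and "degree f = n" and "lead_coeff f = 1"
    and "k < n"
    and "degree g = n - k" and "lead_coeff g = 1"
    and "right_divisor \<sigma> \<delta> g f"
    and "left_divisor \<sigma> \<delta> g f"
    and "degree h \<le> k"
    and "f = skew_mult \<sigma> \<delta> g h"
  shows "parity_check_matrix n k (principal_code \<sigma> \<delta> f g)
           (mat (n - k) n (\<lambda>(t, i).
              if i < t then 0
              else if i = t then (\<sigma> ^^ t) (coeff h k)
              else h_iter \<sigma> \<delta> f k h i (k + t))) \<and>
         (\<forall>t<n - k. \<forall>i<n.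
            (i < t \<longrightarrow> h_iter \<sigma> \<delta> f k h i (k + t) = 0) \<and>
            (i = t \<longrightarrow> h_iter \<sigma> \<delta> f k h i (k + t) = (\<sigma> ^^ t) (coeff h k))) \<and>
         (\<forall>j\<in>{k + 1..n - 1}. h_iter \<sigma> \<delta> f k h 0 j = 0) \<and>
         (\<forall>i\<in>{1..n - k - 1}.
            h_iter \<sigma> \<delta> f k h i 0 = \<delta> (h_iter \<sigma> \<delta> f k h (i - 1) 0) \<and>
            (\<forall>j\<in>{1..n - 2}.
               h_iter \<sigma> \<delta> f k h i j =
                 \<delta> (h_iter \<sigma> \<delta> f k h (i - 1) j) + \<sigma> (h_iter \<sigma> \<delta> f k h (i - 1) (j - 1)))) \<and>
         (\<forall>i\<in>{n - k..n - 1}.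
            h_iter \<sigma> \<delta> f k h i 0 =
              \<delta> (h_iter \<sigma> \<delta> f k h (i - 1) 0)
                - coeff f 0 * \<sigma> (h_iter \<sigma> \<delta> f k h (i - 1) (n - 1)) \<and>
            (\<forall>j\<in>{1..n - 1}.
               h_iter \<sigma> \<delta> f k h i j =
                 \<delta> (h_iter \<sigma> \<delta> f k h (i - 1) j) + \<sigma> (h_iter \<sigma> \<delta> f k h (i - 1) (j - 1))
                   - coeff f j * \<sigma> (h_iter \<sigma> \<delta> f k h (i - 1) (n - 1))))"
proof -
  interpret skew_code \<sigma> \<delta> f g h n k
    by (intro skew_code.intro skew_polynomials.intro skew_polynomials_axioms.intro
        skew_code_axioms.intro) (use assms in auto)
  have "mat (n - k) n (\<lambda>(t, i). if i < t then 0 else if i = t then (\<sigma> ^^ t) (coeff h k)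
      else hi i (k + t)) = check"
    by (rule eq_matI) (auto simp: check_def hi_above hi_diagonal)
  moreover have "hi i j = \<delta> (hi (i - 1) j) + (if j = 0 then 0 else \<sigma> (hi (i - 1) (j - 1))) -
      coeff f j * \<sigma> (hi (i - 1) (n - 1))" if "0 < i" "j < n" for i j
    using hi_Suc[OF \<open>j < n\<close>, of "i - 1"] \<open>0 < i\<close> by simp
  moreover have "hi (i - 1) (n - 1) = 0" if "i \<in> {1..n - k - 1}" for i
    using that by (intro hi_above) auto
  ultimately show ?thesis
    using parity_check_matrix_check k_less
    by (auto simp: hi_0 hi_above hi_diagonal)
qed

end
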